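(* Let $R$ be an associative ring with identity and let $M$ be a projective unital right $R$-module that generates its kernels. Set $S=\operatorname{End}_R(M)$ and assume that the center $Z(S)$ is von Neumann regular. Then the following are equivalent: (1) $M$ is centrally morphic; (2) $M$ is centrally quasi-morphic; (3) $S$ is right centrally morphic.
   Context: All rings are associative with identity and modules are unital right modules; $S=\operatorname{End}_R(M)$ acts on $M$ on the left. $Z(T)$ denotes the center of a ring $T$. For a ring $T$ and $a\in T$, $\operatorname{r.ann}_T(a)=\{x\in T: ax=0\}$. $M$ generates its kernels if for every $f\in S$, $\ker f=\sum\{\operatorname{im}\gamma : \gamma\in S,\ \operatorname{im}\gamma\subseteq\ker f\}$. $M$ is centrally quasi-morphic if for every $f\in S$ there exist $g,h\in Z(S)$ with $\operatorname{im} f=\ker g$ and $\ker f=\operatorname{im} h$. $M$ is centrally morphic if for every $f\in S$ there exists a single $g\in Z(S)$ with $\operatorname{im} f=\ker g$ and $\ker f=\operatorname{im} g$. A ring $T$ is right centrally morphic if for every $a\in T$ there exists $b\in Z(T)$ with $\operatorname{r.ann}_T(a)=bT$ and $aT=\operatorname{r.ann}_T(b)$. A ring $T$ is von Neumann regular if for every $z\in T$ there is $x\in T$ with $z=zxz$. *)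

theory Defs
  imports "HOL-Algebra.AbelCoset"
begin

section \<open>Right modules over a ring\<close>

text \<open>The library's \<open>module\<close> is restricted to commutative rings, with scalars acting on the left.
  As there, the multiplicative part of the record extending \<open>ring\<close> is irrelevant.\<close>

record ('r, 'm) rmodule = "'m ring" +
  raction :: "['m, 'r] \<Rightarrow> 'm" (infixl \<open>\<cdot>\<index>\<close> 70)

locale right_module = R?: ring R + M?: abelian_group M
  for R :: "('r, 'x) ring_scheme" (structure) and M :: "('r, 'm) rmodule" (structure) +
  assumes raction_closed [simp, intro]:
      "\<lbrakk>x \<in> carrier M; a \<in> carrier R\<rbrakk> \<Longrightarrow> x \<cdot>\<^bsub>M\<^esub> a \<in> carrier M"
    and raction_add_left:
      "\<lbrakk>x \<in> carrier M; y \<in> carrier M; a \<in> carrier R\<rbrakk> \<Longrightarrow>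
        (x \<oplus>\<^bsub>M\<^esub> y) \<cdot>\<^bsub>M\<^esub> a = x \<cdot>\<^bsub>M\<^esub> a \<oplus>\<^bsub>M\<^esub> y \<cdot>\<^bsub>M\<^esub> a"
    and raction_add_right:
      "\<lbrakk>x \<in> carrier M; a \<in> carrier R; b \<in> carrier R\<rbrakk> \<Longrightarrow>
        x \<cdot>\<^bsub>M\<^esub> (a \<oplus>\<^bsub>R\<^esub> b) = x \<cdot>\<^bsub>M\<^esub> a \<oplus>\<^bsub>M\<^esub> x \<cdot>\<^bsub>M\<^esub> b"
    and raction_assoc:
      "\<lbrakk>x \<in> carrier M; a \<in> carrier R; b \<in> carrier R\<rbrakk> \<Longrightarrow>
        x \<cdot>\<^bsub>M\<^esub> (a \<otimes>\<^bsub>R\<^esub> b) = x \<cdot>\<^bsub>M\<^esub> a \<cdot>\<^bsub>M\<^esub> b"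
    and raction_one [simp]:
      "x \<in> carrier M \<Longrightarrow> x \<cdot>\<^bsub>M\<^esub> \<one>\<^bsub>R\<^esub> = x"

definition rmodule_hom ::
  "('r, 'x) ring_scheme \<Rightarrow> ('r, 'm) rmodule \<Rightarrow> ('r, 'n) rmodule \<Rightarrow> ('m \<Rightarrow> 'n) set" where
  "rmodule_hom R M N = {f \<in> carrier M \<rightarrow> carrier N.
     (\<forall>x\<in>carrier M. \<forall>y\<in>carrier M. f (x \<oplus>\<^bsub>M\<^esub> y) = f x \<oplus>\<^bsub>N\<^esub> f y) \<and>
     (\<forall>x\<in>carrier M. \<forall>a\<in>carrier R. f (x \<cdot>\<^bsub>M\<^esub> a) = f x \<cdot>\<^bsub>N\<^esub> a)}"

text \<open>Endomorphisms are taken extensional, so that equality in the ring is equality of maps on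
  \<^term>\<open>carrier M\<close>; the product is composition \<open>(f \<otimes> g) x = f (g x)\<close>.\<close>

definition End_ring :: "('r, 'x) ring_scheme \<Rightarrow> ('r, 'm) rmodule \<Rightarrow> ('m \<Rightarrow> 'm) ring" where
  "End_ring R M = \<lparr>
     carrier = rmodule_hom R M M \<inter> extensional (carrier M),
     mult = (\<lambda>f g. compose (carrier M) f g),
     one = (\<lambda>x\<in>carrier M. x),
     zero = (\<lambda>x\<in>carrier M. \<zero>\<^bsub>M\<^esub>),
     add = (\<lambda>f g. \<lambda>x\<in>carrier M. f x \<oplus>\<^bsub>M\<^esub> g x)\<rparr>"

text \<open>Projectivity is the lifting property along epimorphisms \<open>N \<rightarrow> L\<close>. A definition in HOL cannot
  quantify over the types carrying \<open>N\<close> and \<open>L\<close>, so these are fixed: \<open>N\<close> lives on a type large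
  enough for the free module on \<open>M\<close>, and \<open>L\<close> on that of \<open>M\<close>. This is no restriction:
  the lemma \<open>projective_lifting\<close> below yields the lifting property for test modules on
  arbitrary types.\<close>

definition projective_rmodule :: "('r, 'x) ring_scheme \<Rightarrow> ('r, 'm) rmodule \<Rightarrow> bool" where
  "projective_rmodule R M \<longleftrightarrow> right_module R M \<and>
     (\<forall>(N :: ('r, 'm \<Rightarrow> 'r) rmodule) (L :: ('r, 'm) rmodule).
        \<forall>g \<in> rmodule_hom R N L. \<forall>f \<in> rmodule_hom R M L.
          right_module R N \<longrightarrow> right_module R L \<longrightarrow> g ` carrier N = carrier L \<longrightarrow>
          (\<exists>h \<in> rmodule_hom R M N. \<forall>x\<in>carrier M. g (h x) = f x))"

text \<open>The sum of a family of submodules: all sums of finitely many elements,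
  each from a different member of the family.\<close>

definition submodule_sum :: "('r, 'm) rmodule \<Rightarrow> 'm set set \<Rightarrow> 'm set" where
  "submodule_sum M \<N> =
     {finsum M u \<F> | u \<F>. finite \<F> \<and> \<F> \<subseteq> \<N> \<and> (\<forall>N\<in>\<F>. u N \<in> N)}"

abbreviation rmodule_im :: "('r, 'm) rmodule \<Rightarrow> ('m \<Rightarrow> 'm) \<Rightarrow> 'm set" where
  "rmodule_im M f \<equiv> f ` carrier M"

abbreviation rmodule_ker :: "('r, 'm) rmodule \<Rightarrow> ('m \<Rightarrow> 'm) \<Rightarrow> 'm set" where
  "rmodule_ker M f \<equiv> a_kernel M M f"

definition generates_kernels :: "('r, 'x) ring_scheme \<Rightarrow> ('r, 'm) rmodule \<Rightarrow> bool" where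
  "generates_kernels R M \<longleftrightarrow> (\<forall>f \<in> carrier (End_ring R M).
     rmodule_ker M f = submodule_sum M
       {rmodule_im M \<gamma> | \<gamma>. \<gamma> \<in> carrier (End_ring R M) \<and> rmodule_im M \<gamma> \<subseteq> rmodule_ker M f})"


section \<open>Rings\<close>

definition ring_center :: "('a, 'x) ring_scheme \<Rightarrow> 'a set" where
  "ring_center T = {z \<in> carrier T. \<forall>t\<in>carrier T. z \<otimes>\<^bsub>T\<^esub> t = t \<otimes>\<^bsub>T\<^esub> z}"

definition center_ring :: "('a, 'x) ring_scheme \<Rightarrow> ('a, 'x) ring_scheme" where
  "center_ring T = T\<lparr>carrier := ring_center T\<rparr>"

definition von_neumann_regular :: "('a, 'x) ring_scheme \<Rightarrow> bool" where
  "von_neumann_regular T \<longleftrightarrow>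
     ring T \<and> (\<forall>z\<in>carrier T. \<exists>x\<in>carrier T. z = z \<otimes>\<^bsub>T\<^esub> x \<otimes>\<^bsub>T\<^esub> z)"

definition r_ann :: "('a, 'x) ring_scheme \<Rightarrow> 'a \<Rightarrow> 'a set" where
  "r_ann T a = {x \<in> carrier T. a \<otimes>\<^bsub>T\<^esub> x = \<zero>\<^bsub>T\<^esub>}"

text \<open>The library's left coset \<open>b <# carrier T\<close> of the whole (multiplicative) monoid is the
  principal right ideal \<open>bT\<close>.\<close>

definition right_centrally_morphic :: "('a, 'x) ring_scheme \<Rightarrow> bool" where
  "right_centrally_morphic T \<longleftrightarrow> ring T \<and> (\<forall>a\<in>carrier T. \<exists>b\<in>ring_center T.
     r_ann T a = b <#\<^bsub>T\<^esub> carrier T \<and> a <#\<^bsub>T\<^esub> carrier T = r_ann T b)"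


section \<open>Centrally morphic modules\<close>

definition centrally_quasi_morphic :: "('r, 'x) ring_scheme \<Rightarrow> ('r, 'm) rmodule \<Rightarrow> bool" where
  "centrally_quasi_morphic R M \<longleftrightarrow> (\<forall>f \<in> carrier (End_ring R M).
     \<exists>g \<in> ring_center (End_ring R M). \<exists>h \<in> ring_center (End_ring R M).
       rmodule_im M f = rmodule_ker M g \<and> rmodule_ker M f = rmodule_im M h)"

definition centrally_morphic :: "('r, 'x) ring_scheme \<Rightarrow> ('r, 'm) rmodule \<Rightarrow> bool" where
  "centrally_morphic R M \<longleftrightarrow> (\<forall>f \<in> carrier (End_ring R M).
     \<exists>g \<in> ring_center (End_ring R M).
       rmodule_im M f = rmodule_ker M g \<and> rmodule_ker M f = rmodule_im M g)"


section \<open>The endomorphism ring and its center are rings\<close>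

lemma End_ring_simps:
  "carrier (End_ring R M) = rmodule_hom R M M \<inter> extensional (carrier M)"
  "f \<otimes>\<^bsub>End_ring R M\<^esub> g = compose (carrier M) f g"
  "\<one>\<^bsub>End_ring R M\<^esub> = (\<lambda>x\<in>carrier M. x)"
  "\<zero>\<^bsub>End_ring R M\<^esub> = (\<lambda>x\<in>carrier M. \<zero>\<^bsub>M\<^esub>)"
  "f \<oplus>\<^bsub>End_ring R M\<^esub> g = (\<lambda>x\<in>carrier M. f x \<oplus>\<^bsub>M\<^esub> g x)"
  by (simp_all add: End_ring_def)

lemma rmodule_homD:
  assumes "f \<in> rmodule_hom R M N"
  shows "x \<in> carrier M \<Longrightarrow> f x \<in> carrier N"
    and "\<lbrakk>x \<in> carrier M; y \<in> carrier M\<rbrakk> \<Longrightarrow> f (x \<oplus>\<^bsub>M\<^esub> y) = f x \<oplus>\<^bsub>N\<^esub> f y"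
    and "\<lbrakk>x \<in> carrier M; a \<in> carrier R\<rbrakk> \<Longrightarrow> f (x \<cdot>\<^bsub>M\<^esub> a) = f x \<cdot>\<^bsub>N\<^esub> a"
  using assms by (auto simp: rmodule_hom_def)

lemma rmodule_homI:
  assumes "\<And>x. x \<in> carrier M \<Longrightarrow> f x \<in> carrier N"
    and "\<And>x y. \<lbrakk>x \<in> carrier M; y \<in> carrier M\<rbrakk> \<Longrightarrow> f (x \<oplus>\<^bsub>M\<^esub> y) = f x \<oplus>\<^bsub>N\<^esub> f y"
    and "\<And>x a. \<lbrakk>x \<in> carrier M; a \<in> carrier R\<rbrakk> \<Longrightarrow> f (x \<cdot>\<^bsub>M\<^esub> a) = f x \<cdot>\<^bsub>N\<^esub> a"
  shows "f \<in> rmodule_hom R M N"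
  using assms by (auto simp: rmodule_hom_def)

lemma (in right_module) raction_zero_left:
  assumes a: "a \<in> carrier R" shows "\<zero>\<^bsub>M\<^esub> \<cdot>\<^bsub>M\<^esub> a = \<zero>\<^bsub>M\<^esub>"
proof -
  have "\<zero>\<^bsub>M\<^esub> \<cdot>\<^bsub>M\<^esub> a \<oplus>\<^bsub>M\<^esub> \<zero>\<^bsub>M\<^esub> \<cdot>\<^bsub>M\<^esub> a = \<zero>\<^bsub>M\<^esub> \<cdot>\<^bsub>M\<^esub> a"
    using raction_add_left[of "\<zero>\<^bsub>M\<^esub>" "\<zero>\<^bsub>M\<^esub>" a] a by simp
  then show ?thesis using a by (metis M.add.l_cancel_one' M.zero_closed raction_closed)
qed

lemma (in right_module) raction_zero_right:
  assumes x: "x \<in> carrier M" shows "x \<cdot>\<^bsub>M\<^esub> \<zero>\<^bsub>R\<^esub> = \<zero>\<^bsub>M\<^esub>"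
proof -
  have "x \<cdot>\<^bsub>M\<^esub> \<zero>\<^bsub>R\<^esub> \<oplus>\<^bsub>M\<^esub> x \<cdot>\<^bsub>M\<^esub> \<zero>\<^bsub>R\<^esub> = x \<cdot>\<^bsub>M\<^esub> \<zero>\<^bsub>R\<^esub>"
    using raction_add_right[of x "\<zero>\<^bsub>R\<^esub>" "\<zero>\<^bsub>R\<^esub>"] x by simp
  then show ?thesis using x by (metis M.add.l_cancel_one' R.zero_closed raction_closed)
qed

lemma (in right_module) raction_a_inv:
  assumes x: "x \<in> carrier M" and a: "a \<in> carrier R"
  shows "(\<ominus>\<^bsub>M\<^esub> x) \<cdot>\<^bsub>M\<^esub> a = \<ominus>\<^bsub>M\<^esub> (x \<cdot>\<^bsub>M\<^esub> a)"
proof -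
  have "(\<ominus>\<^bsub>M\<^esub> x) \<cdot>\<^bsub>M\<^esub> a \<oplus>\<^bsub>M\<^esub> x \<cdot>\<^bsub>M\<^esub> a = \<zero>\<^bsub>M\<^esub>"
    using raction_add_left[of "\<ominus>\<^bsub>M\<^esub> x" x a] x a by (simp add: M.l_neg raction_zero_left)
  then show ?thesis using x a by (simp add: M.minus_equality)
qed

lemma rmodule_hom_zero:
  assumes "right_module R M" "right_module R N" and f: "f \<in> rmodule_hom R M N"
  shows "f \<zero>\<^bsub>M\<^esub> = \<zero>\<^bsub>N\<^esub>"
proof -
  interpret M: right_module R M by fact
  interpret N: right_module R N by fact
  have "f (\<zero>\<^bsub>M\<^esub> \<cdot>\<^bsub>M\<^esub> \<zero>\<^bsub>R\<^esub>) = f \<zero>\<^bsub>M\<^esub> \<cdot>\<^bsub>N\<^esub> \<zero>\<^bsub>R\<^esub>"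
    using rmodule_homD(3)[OF f] by simp
  then show ?thesis
    using rmodule_homD(1)[OF f, of "\<zero>\<^bsub>M\<^esub>"]
    by (simp add: M.raction_zero_left N.raction_zero_right)
qed

context right_module
begin

lemma End_ringI:
  assumes "f \<in> rmodule_hom R M M"
  shows "restrict f (carrier M) \<in> carrier (End_ring R M)"
  using assms by (auto simp: End_ring_simps rmodule_hom_def)

lemma End_ring_ext:
  assumes "f \<in> carrier (End_ring R M)" "g \<in> carrier (End_ring R M)"
    and "\<And>x. x \<in> carrier M \<Longrightarrow> f x = g x"
  shows "f = g"
  using assms by (auto simp: End_ring_simps intro: extensionalityI)

lemma End_ring_closed:
  assumes "f \<in> carrier (End_ring R M)" "x \<in> carrier M" shows "f x \<in> carrier M"
  using assms rmodule_homD(1) by (fastforce simp: End_ring_simps)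

lemma End_ring_add_closed:
  assumes "f \<in> carrier (End_ring R M)" "g \<in> carrier (End_ring R M)"
  shows "f \<oplus>\<^bsub>End_ring R M\<^esub> g \<in> carrier (End_ring R M)"
  unfolding End_ring_simps(5) using assms
  by (intro End_ringI rmodule_homI)
     (auto simp: End_ring_simps rmodule_homD M.a_ac raction_add_left)

lemma End_ring_mult_closed:
  assumes "f \<in> carrier (End_ring R M)" "g \<in> carrier (End_ring R M)"
  shows "f \<otimes>\<^bsub>End_ring R M\<^esub> g \<in> carrier (End_ring R M)"
  unfolding End_ring_simps(2) compose_def using assms
  by (intro End_ringI rmodule_homI) (auto simp: End_ring_simps rmodule_homD)

lemma End_ring_zero_closed: "\<zero>\<^bsub>End_ring R M\<^esub> \<in> carrier (End_ring R M)"
  unfolding End_ring_simps(4)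
  by (intro End_ringI rmodule_homI) (auto simp: raction_zero_left)

lemma End_ring_one_closed: "\<one>\<^bsub>End_ring R M\<^esub> \<in> carrier (End_ring R M)"
  unfolding End_ring_simps(3) by (intro End_ringI rmodule_homI) auto

lemma End_ring_neg_closed:
  assumes "f \<in> carrier (End_ring R M)"
  shows "(\<lambda>x\<in>carrier M. \<ominus>\<^bsub>M\<^esub> f x) \<in> carrier (End_ring R M)"
  using assms
  by (intro End_ringI rmodule_homI)
     (auto simp: End_ring_simps rmodule_homD M.minus_add raction_a_inv)

theorem ring_End_ring: "ring (End_ring R M)"
proof (rule ringI)
  note closed = End_ring_add_closed End_ring_mult_closed End_ring_zero_closed
    End_ring_one_closed End_ring_closed
  show "abelian_group (End_ring R M)"
  proof (rule abelian_groupI)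
    fix f assume f: "f \<in> carrier (End_ring R M)"
    show "\<exists>g\<in>carrier (End_ring R M). g \<oplus>\<^bsub>End_ring R M\<^esub> f = \<zero>\<^bsub>End_ring R M\<^esub>"
      by (rule bexI[OF _ End_ring_neg_closed[OF f]])
         (use f in \<open>auto simp: End_ring_simps(4,5) End_ring_closed M.l_neg\<close>)
    show "\<zero>\<^bsub>End_ring R M\<^esub> \<oplus>\<^bsub>End_ring R M\<^esub> f = f"
      using f by (intro End_ring_ext) (auto simp: closed, auto simp: End_ring_simps(4,5) closed)
  next
    fix f g h
    assume "f \<in> carrier (End_ring R M)" "g \<in> carrier (End_ring R M)" "h \<in> carrier (End_ring R M)"
    then show "f \<oplus>\<^bsub>End_ring R M\<^esub> g \<oplus>\<^bsub>End_ring R M\<^esub> h = f \<oplus>\<^bsub>End_ring R M\<^esub> (g \<oplus>\<^bsub>End_ring R M\<^esub> h)"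
      by (intro End_ring_ext) (auto simp: closed, auto simp: End_ring_simps(5) closed M.a_assoc)
  next
    fix f g
    assume "f \<in> carrier (End_ring R M)" "g \<in> carrier (End_ring R M)"
    then show "f \<oplus>\<^bsub>End_ring R M\<^esub> g = g \<oplus>\<^bsub>End_ring R M\<^esub> f"
      by (intro End_ring_ext) (auto simp: closed, auto simp: End_ring_simps(5) closed M.a_comm)
  qed (auto simp: closed)
  show "monoid (End_ring R M)"
  proof (rule monoidI)
    fix f assume f: "f \<in> carrier (End_ring R M)"
    then show "\<one>\<^bsub>End_ring R M\<^esub> \<otimes>\<^bsub>End_ring R M\<^esub> f = f" "f \<otimes>\<^bsub>End_ring R M\<^esub> \<one>\<^bsub>End_ring R M\<^esub> = f"
      by (intro End_ring_ext; auto simp: closed; auto simp: End_ring_simps(2,3) closed compose_def)+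
  next
    fix f g h
    assume "f \<in> carrier (End_ring R M)" "g \<in> carrier (End_ring R M)" "h \<in> carrier (End_ring R M)"
    then show "f \<otimes>\<^bsub>End_ring R M\<^esub> g \<otimes>\<^bsub>End_ring R M\<^esub> h = f \<otimes>\<^bsub>End_ring R M\<^esub> (g \<otimes>\<^bsub>End_ring R M\<^esub> h)"
      by (intro End_ring_ext) (auto simp: closed, auto simp: End_ring_simps(2) closed compose_def)
  qed (auto simp: closed)
  fix f g h
  assume fgh: "f \<in> carrier (End_ring R M)" "g \<in> carrier (End_ring R M)" "h \<in> carrier (End_ring R M)"
  then show "(f \<oplus>\<^bsub>End_ring R M\<^esub> g) \<otimes>\<^bsub>End_ring R M\<^esub> h =
      f \<otimes>\<^bsub>End_ring R M\<^esub> h \<oplus>\<^bsub>End_ring R M\<^esub> g \<otimes>\<^bsub>End_ring R M\<^esub> h"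
    by (intro End_ring_ext) (auto simp: closed, auto simp: End_ring_simps(2,5) closed compose_def)
  have add: "h (x \<oplus>\<^bsub>M\<^esub> y) = h x \<oplus>\<^bsub>M\<^esub> h y" if "x \<in> carrier M" "y \<in> carrier M" for x y
    using fgh that rmodule_homD(2) by (fastforce simp: End_ring_simps)
  show "h \<otimes>\<^bsub>End_ring R M\<^esub> (f \<oplus>\<^bsub>End_ring R M\<^esub> g) =
      h \<otimes>\<^bsub>End_ring R M\<^esub> f \<oplus>\<^bsub>End_ring R M\<^esub> h \<otimes>\<^bsub>End_ring R M\<^esub> g"
    using fgh
    by (intro End_ring_ext) (auto simp: closed, auto simp: End_ring_simps(2,5) closed compose_def add)
qed

end

lemma ring_centerD:
  assumes "z \<in> ring_center T"
  shows "z \<in> carrier T" and "t \<in> carrier T \<Longrightarrow> z \<otimes>\<^bsub>T\<^esub> t = t \<otimes>\<^bsub>T\<^esub> z"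
  using assms unfolding ring_center_def by blast+

lemma ring_centerI:
  assumes "z \<in> carrier T" and "\<And>t. t \<in> carrier T \<Longrightarrow> z \<otimes>\<^bsub>T\<^esub> t = t \<otimes>\<^bsub>T\<^esub> z"
  shows "z \<in> ring_center T"
  using assms unfolding ring_center_def by blast

lemma (in ring) cring_center_ring: "cring (center_ring R)"
proof -
  have neg: "\<ominus> z \<in> ring_center R" if z: "z \<in> ring_center R" for z
  proof (rule ring_centerI)
    fix t assume t: "t \<in> carrier R"
    have "\<ominus> z \<otimes> t = \<ominus> (z \<otimes> t)" using ring_centerD(1)[OF z] t by (simp add: l_minus)
    also have "\<dots> = t \<otimes> \<ominus> z"
      unfolding ring_centerD(2)[OF z t] using ring_centerD(1)[OF z] t by (simp add: r_minus)
    finally show "\<ominus> z \<otimes> t = t \<otimes> \<ominus> z" .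
  qed (simp add: ring_centerD(1)[OF z])
  have mult: "z \<otimes> w \<in> ring_center R" if z: "z \<in> ring_center R" and w: "w \<in> ring_center R" for z w
  proof (rule ring_centerI)
    note c = ring_centerD(1)[OF z] ring_centerD(1)[OF w]
    fix t assume t: "t \<in> carrier R"
    have "z \<otimes> w \<otimes> t = z \<otimes> (t \<otimes> w)"
      using c t by (simp add: m_assoc ring_centerD(2)[OF w t])
    also have "\<dots> = t \<otimes> z \<otimes> w"
      using c t by (simp add: m_assoc[symmetric] ring_centerD(2)[OF z t])
    finally show "z \<otimes> w \<otimes> t = t \<otimes> (z \<otimes> w)" using c t by (simp add: m_assoc)
  qed (simp add: ring_centerD(1)[OF z] ring_centerD(1)[OF w])
  have add: "z \<oplus> w \<in> ring_center R" if z: "z \<in> ring_center R" and w: "w \<in> ring_center R" for z w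
  proof (rule ring_centerI)
    fix t assume t: "t \<in> carrier R"
    show "(z \<oplus> w) \<otimes> t = t \<otimes> (z \<oplus> w)"
      using ring_centerD(1)[OF z] ring_centerD(1)[OF w] t
      by (simp add: l_distr r_distr ring_centerD(2)[OF z t] ring_centerD(2)[OF w t])
  qed (simp add: ring_centerD(1)[OF z] ring_centerD(1)[OF w])
  have units: "\<zero> \<in> ring_center R" "\<one> \<in> ring_center R"
    by (auto intro: ring_centerI)
  have sel: "carrier (center_ring R) = ring_center R" "add (center_ring R) = add R"
    "mult (center_ring R) = mult R" "zero (center_ring R) = \<zero>" "one (center_ring R) = \<one>"
    by (simp_all add: center_ring_def)
  show ?thesis
  proof (rule cringI)
    show "abelian_group (center_ring R)"
    proof (rule abelian_groupI, unfold sel)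
      fix z assume z: "z \<in> ring_center R"
      then show "\<exists>y\<in>ring_center R. y \<oplus> z = \<zero>"
        using neg[OF z] ring_centerD(1)[OF z] by (intro bexI[of _ "\<ominus> z"]) (simp_all add: l_neg)
    qed (auto simp: add units a_ac ring_centerD(1))
    show "comm_monoid (center_ring R)"
      by (rule comm_monoidI, unfold sel)
         (auto simp: mult units m_assoc ring_centerD(1) intro: ring_centerD)
  qed (simp add: sel l_distr ring_centerD(1))
qed


section \<open>Projective modules lift against all epimorphisms\<close>

text \<open>The free right module on the set \<^term>\<open>carrier M\<close>.\<close>

definition free_rmodule :: "('r, 'x) ring_scheme \<Rightarrow> 'm set \<Rightarrow> ('r, 'm \<Rightarrow> 'r) rmodule" where
  "free_rmodule R X = \<lparr>
     carrier = {\<phi>. (\<forall>x. \<phi> x \<in> carrier R) \<and> finite {x. \<phi> x \<noteq> \<zero>\<^bsub>R\<^esub>} \<and> {x. \<phi> x \<noteq> \<zero>\<^bsub>R\<^esub>} \<subseteq> X},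
     mult = undefined, one = undefined,
     zero = (\<lambda>_. \<zero>\<^bsub>R\<^esub>),
     add = (\<lambda>\<phi> \<psi> x. \<phi> x \<oplus>\<^bsub>R\<^esub> \<psi> x),
     raction = (\<lambda>\<phi> a x. \<phi> x \<otimes>\<^bsub>R\<^esub> a)\<rparr>"

lemma free_rmodule_carrier:
  "\<phi> \<in> carrier (free_rmodule R X) \<longleftrightarrow>
     (\<forall>x. \<phi> x \<in> carrier R) \<and> finite {x. \<phi> x \<noteq> \<zero>\<^bsub>R\<^esub>} \<and> {x. \<phi> x \<noteq> \<zero>\<^bsub>R\<^esub>} \<subseteq> X"
  by (simp add: free_rmodule_def)

lemma (in ring) right_module_free_rmodule: "right_module R (free_rmodule R X)"
proof -
  let ?F = "free_rmodule R X"
  have supp: "\<phi> \<in> carrier ?F" if "\<And>x. \<phi> x \<in> carrier R" "{x. \<phi> x \<noteq> \<zero>} \<subseteq> A" "finite A" "A \<subseteq> X"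
    for \<phi> A
    using that finite_subset[of "{x. \<phi> x \<noteq> \<zero>}" A] by (auto simp: free_rmodule_carrier)
  have add_closed: "(\<lambda>x. \<phi> x \<oplus> \<psi> x) \<in> carrier ?F"
    if "\<phi> \<in> carrier ?F" "\<psi> \<in> carrier ?F" for \<phi> \<psi>
    by (rule supp[of _ "{x. \<phi> x \<noteq> \<zero>} \<union> {x. \<psi> x \<noteq> \<zero>}"])
       (use that in \<open>auto simp: free_rmodule_carrier\<close>)
  have act_closed: "(\<lambda>x. \<phi> x \<otimes> a) \<in> carrier ?F" if "\<phi> \<in> carrier ?F" "a \<in> carrier R" for \<phi> a
    by (rule supp[of _ "{x. \<phi> x \<noteq> \<zero>}"]) (use that in \<open>auto simp: free_rmodule_carrier\<close>)
  have neg_closed: "(\<lambda>x. \<ominus> \<phi> x) \<in> carrier ?F" if "\<phi> \<in> carrier ?F" for \<phi>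
    by (rule supp[of _ "{x. \<phi> x \<noteq> \<zero>}"]) (use that in \<open>auto simp: free_rmodule_carrier\<close>)
  have zero_closed: "(\<lambda>_. \<zero>) \<in> carrier ?F"
    by (rule supp[of _ "{}"]) auto
  have val: "\<phi> x \<in> carrier R" if "\<phi> \<in> carrier ?F" for \<phi> x
    using that by (auto simp: free_rmodule_carrier)
  have sel: "\<zero>\<^bsub>?F\<^esub> = (\<lambda>_. \<zero>)" "\<phi> \<oplus>\<^bsub>?F\<^esub> \<psi> = (\<lambda>x. \<phi> x \<oplus> \<psi> x)" "\<phi> \<cdot>\<^bsub>?F\<^esub> a = (\<lambda>x. \<phi> x \<otimes> a)" for \<phi> \<psi> a
    by (simp_all add: free_rmodule_def)
  have "abelian_group ?F"
  proof (rule abelian_groupI)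
    fix \<phi> assume \<phi>: "\<phi> \<in> carrier ?F"
    show "\<exists>\<psi>\<in>carrier ?F. \<psi> \<oplus>\<^bsub>?F\<^esub> \<phi> = \<zero>\<^bsub>?F\<^esub>"
      by (rule bexI[OF _ neg_closed[OF \<phi>]]) (use \<phi> in \<open>simp add: sel val l_neg\<close>)
  qed (auto simp: sel add_closed zero_closed val a_ac)
  then show ?thesis
    by (intro right_module.intro right_module_axioms.intro ring_axioms)
       (auto simp: sel act_closed val l_distr r_distr m_assoc)
qed

text \<open>The linear extension of \<open>c\<close> to the free module.\<close>

definition lin_ext :: "('r, 'x) ring_scheme \<Rightarrow> ('r, 'n) rmodule \<Rightarrow> ('m \<Rightarrow> 'n) \<Rightarrow> ('m \<Rightarrow> 'r) \<Rightarrow> 'n" where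
  "lin_ext R N c \<phi> = (\<Oplus>\<^bsub>N\<^esub>x\<in>{x. \<phi> x \<noteq> \<zero>\<^bsub>R\<^esub>}. c x \<cdot>\<^bsub>N\<^esub> \<phi> x)"

context right_module
begin

lemma lin_ext_superset:
  assumes c: "c \<in> X \<rightarrow> carrier M" and \<phi>: "\<phi> \<in> carrier (free_rmodule R X)"
    and A: "{x. \<phi> x \<noteq> \<zero>\<^bsub>R\<^esub>} \<subseteq> A" "finite A" "A \<subseteq> X"
  shows "lin_ext R M c \<phi> = (\<Oplus>\<^bsub>M\<^esub>x\<in>A. c x \<cdot>\<^bsub>M\<^esub> \<phi> x)"
  unfolding lin_ext_def
proof (rule M.add.finprod_mono_neutral_cong_left)
  show "\<And>i. i \<in> A - {x. \<phi> x \<noteq> \<zero>\<^bsub>R\<^esub>} \<Longrightarrow> c i \<cdot>\<^bsub>M\<^esub> \<phi> i = \<zero>\<^bsub>M\<^esub>"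
    using c A by (auto simp: raction_zero_right Pi_iff subset_iff)
  show "(\<lambda>x. c x \<cdot>\<^bsub>M\<^esub> \<phi> x) \<in> A \<rightarrow> carrier M"
    using c A \<phi> by (auto simp: free_rmodule_carrier Pi_iff subset_iff)
qed (use A in auto)

lemma raction_finsum:
  assumes "finite A" "u \<in> A \<rightarrow> carrier M" "a \<in> carrier R"
  shows "(\<Oplus>\<^bsub>M\<^esub>x\<in>A. u x) \<cdot>\<^bsub>M\<^esub> a = (\<Oplus>\<^bsub>M\<^esub>x\<in>A. u x \<cdot>\<^bsub>M\<^esub> a)"
  using assms
proof (induction A rule: finite_induct)
  case empty
  then show ?case by (simp add: raction_zero_left)
next
  case (insert y A)
  then have "u \<in> A \<rightarrow> carrier M" "u y \<in> carrier M" "(\<lambda>x. u x \<cdot>\<^bsub>M\<^esub> a) \<in> A \<rightarrow> carrier M"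
    by auto
  with insert show ?case
    by (simp add: M.finsum_insert M.finsum_closed raction_add_left)
qed

lemma lin_ext_hom:
  assumes c: "c \<in> X \<rightarrow> carrier M"
  shows "lin_ext R M c \<in> rmodule_hom R (free_rmodule R X) M"
proof (rule rmodule_homI)
  let ?F = "free_rmodule R X"
  interpret F: right_module R ?F by (rule R.right_module_free_rmodule)
  have mem: "(\<lambda>x. c x \<cdot>\<^bsub>M\<^esub> \<phi> x) \<in> A \<rightarrow> carrier M"
    if "\<phi> \<in> carrier ?F" "A \<subseteq> X" for \<phi> A
    using that c by (auto simp: free_rmodule_carrier Pi_iff subset_iff)
  have sel: "\<phi> \<oplus>\<^bsub>?F\<^esub> \<psi> = (\<lambda>x. \<phi> x \<oplus>\<^bsub>R\<^esub> \<psi> x)" "\<phi> \<cdot>\<^bsub>?F\<^esub> a = (\<lambda>x. \<phi> x \<otimes>\<^bsub>R\<^esub> a)" for \<phi> \<psi> a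
    by (simp_all add: free_rmodule_def)
  fix \<phi> assume \<phi>: "\<phi> \<in> carrier ?F"
  let ?A = "{x. \<phi> x \<noteq> \<zero>\<^bsub>R\<^esub>}"
  have A: "finite ?A" "?A \<subseteq> X" and \<phi>v: "\<And>x. \<phi> x \<in> carrier R"
    using \<phi> by (auto simp: free_rmodule_carrier)
  show "lin_ext R M c \<phi> \<in> carrier M"
    unfolding lin_ext_def by (rule M.finsum_closed) (rule mem[OF \<phi> A(2)])
  { fix \<psi> assume \<psi>: "\<psi> \<in> carrier ?F"
    let ?B = "{x. \<psi> x \<noteq> \<zero>\<^bsub>R\<^esub>}"
    have B: "finite ?B" "?B \<subseteq> X" and \<psi>v: "\<And>x. \<psi> x \<in> carrier R"
      using \<psi> by (auto simp: free_rmodule_carrier)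
    have C: "finite (?A \<union> ?B)" "?A \<union> ?B \<subseteq> X" using A B by auto
    have s: "\<phi> \<oplus>\<^bsub>?F\<^esub> \<psi> \<in> carrier ?F" using \<phi> \<psi> by (rule F.a_closed)
    have "lin_ext R M c (\<phi> \<oplus>\<^bsub>?F\<^esub> \<psi>) = (\<Oplus>\<^bsub>M\<^esub>x\<in>?A \<union> ?B. c x \<cdot>\<^bsub>M\<^esub> (\<phi> \<oplus>\<^bsub>?F\<^esub> \<psi>) x)"
      by (rule lin_ext_superset[OF c s _ C]) (auto simp: sel)
    also have "\<dots> = (\<Oplus>\<^bsub>M\<^esub>x\<in>?A \<union> ?B. c x \<cdot>\<^bsub>M\<^esub> \<phi> x \<oplus>\<^bsub>M\<^esub> c x \<cdot>\<^bsub>M\<^esub> \<psi> x)"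
    proof (rule M.finsum_cong')
      show "(\<lambda>x. c x \<cdot>\<^bsub>M\<^esub> \<phi> x \<oplus>\<^bsub>M\<^esub> c x \<cdot>\<^bsub>M\<^esub> \<psi> x) \<in> ?A \<union> ?B \<rightarrow> carrier M"
        using mem[OF \<phi> C(2)] mem[OF \<psi> C(2)] by (auto simp: Pi_iff)
      fix x assume "x \<in> ?A \<union> ?B"
      then have "c x \<in> carrier M" using c C(2) by (auto simp: Pi_iff subset_iff)
      then show "c x \<cdot>\<^bsub>M\<^esub> (\<phi> \<oplus>\<^bsub>?F\<^esub> \<psi>) x = c x \<cdot>\<^bsub>M\<^esub> \<phi> x \<oplus>\<^bsub>M\<^esub> c x \<cdot>\<^bsub>M\<^esub> \<psi> x"
        using raction_add_right \<phi>v \<psi>v by (simp add: sel)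
    qed simp
    also have "\<dots> = (\<Oplus>\<^bsub>M\<^esub>x\<in>?A \<union> ?B. c x \<cdot>\<^bsub>M\<^esub> \<phi> x) \<oplus>\<^bsub>M\<^esub> (\<Oplus>\<^bsub>M\<^esub>x\<in>?A \<union> ?B. c x \<cdot>\<^bsub>M\<^esub> \<psi> x)"
      by (rule M.finsum_addf[OF mem[OF \<phi> C(2)] mem[OF \<psi> C(2)]])
    also have "\<dots> = lin_ext R M c \<phi> \<oplus>\<^bsub>M\<^esub> lin_ext R M c \<psi>"
      using lin_ext_superset[OF c \<phi> _ C] lin_ext_superset[OF c \<psi> _ C] by simp
    finally show "lin_ext R M c (\<phi> \<oplus>\<^bsub>?F\<^esub> \<psi>) = lin_ext R M c \<phi> \<oplus>\<^bsub>M\<^esub> lin_ext R M c \<psi>" . }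
  { fix a assume a: "a \<in> carrier R"
    have s: "\<phi> \<cdot>\<^bsub>?F\<^esub> a \<in> carrier ?F" using \<phi> a by (rule F.raction_closed)
    have "lin_ext R M c (\<phi> \<cdot>\<^bsub>?F\<^esub> a) = (\<Oplus>\<^bsub>M\<^esub>x\<in>?A. c x \<cdot>\<^bsub>M\<^esub> (\<phi> \<cdot>\<^bsub>?F\<^esub> a) x)"
      by (rule lin_ext_superset[OF c s _ A]) (use a in \<open>auto simp: sel\<close>)
    also have "\<dots> = (\<Oplus>\<^bsub>M\<^esub>x\<in>?A. c x \<cdot>\<^bsub>M\<^esub> \<phi> x \<cdot>\<^bsub>M\<^esub> a)"
    proof (rule M.finsum_cong')
      show "(\<lambda>x. c x \<cdot>\<^bsub>M\<^esub> \<phi> x \<cdot>\<^bsub>M\<^esub> a) \<in> ?A \<rightarrow> carrier M"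
        using mem[OF \<phi> A(2)] a by (auto simp: Pi_iff)
      fix x assume "x \<in> ?A"
      then have "c x \<in> carrier M" using c A(2) by (auto simp: Pi_iff subset_iff)
      then show "c x \<cdot>\<^bsub>M\<^esub> (\<phi> \<cdot>\<^bsub>?F\<^esub> a) x = c x \<cdot>\<^bsub>M\<^esub> \<phi> x \<cdot>\<^bsub>M\<^esub> a"
        using raction_assoc \<phi>v a by (simp add: sel)
    qed simp
    also have "\<dots> = lin_ext R M c \<phi> \<cdot>\<^bsub>M\<^esub> a"
      unfolding lin_ext_def using raction_finsum[OF A(1) mem[OF \<phi> A(2)] a] by simp
    finally show "lin_ext R M c (\<phi> \<cdot>\<^bsub>?F\<^esub> a) = lin_ext R M c \<phi> \<cdot>\<^bsub>M\<^esub> a" . }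
qed

lemma lin_ext_surj: "lin_ext R M (\<lambda>x. x) ` carrier (free_rmodule R (carrier M)) = carrier M"
proof
  show "lin_ext R M (\<lambda>x. x) ` carrier (free_rmodule R (carrier M)) \<subseteq> carrier M"
    using rmodule_homD(1)[OF lin_ext_hom[of "\<lambda>x. x" "carrier M"]] by auto
  show "carrier M \<subseteq> lin_ext R M (\<lambda>x. x) ` carrier (free_rmodule R (carrier M))"
  proof
    fix y assume y: "y \<in> carrier M"
    let ?d = "\<lambda>x. if x = y then \<one>\<^bsub>R\<^esub> else \<zero>\<^bsub>R\<^esub>"
    have sub: "{x. ?d x \<noteq> \<zero>\<^bsub>R\<^esub>} \<subseteq> {y}" by auto
    have d: "?d \<in> carrier (free_rmodule R (carrier M))"
      using y finite_subset[OF sub] sub by (auto simp: free_rmodule_carrier)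
    have "lin_ext R M (\<lambda>x. x) ?d = (\<Oplus>\<^bsub>M\<^esub>x\<in>{y}. x \<cdot>\<^bsub>M\<^esub> ?d x)"
      by (rule lin_ext_superset[OF _ d sub]) (use y in auto)
    also have "\<dots> = y" using y by (simp add: M.finsum_insert)
    finally show "y \<in> lin_ext R M (\<lambda>x. x) ` carrier (free_rmodule R (carrier M))"
      using d by force
  qed
qed

end

lemma hom_finsum:
  assumes "right_module R M" "right_module R N" and f: "f \<in> rmodule_hom R M N"
    and "finite A" "u \<in> A \<rightarrow> carrier M"
  shows "f (\<Oplus>\<^bsub>M\<^esub>x\<in>A. u x) = (\<Oplus>\<^bsub>N\<^esub>x\<in>A. f (u x))"
proof -
  interpret M: right_module R M by fact
  interpret N: right_module R N by fact
  show ?thesis using \<open>finite A\<close> \<open>u \<in> A \<rightarrow> carrier M\<close>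
  proof (induction A rule: finite_induct)
    case empty
    then show ?case by (simp add: rmodule_hom_zero[OF assms(1-3)])
  next
    case (insert y A)
    then have "u \<in> A \<rightarrow> carrier M" "u y \<in> carrier M" "(\<lambda>x. f (u x)) \<in> A \<rightarrow> carrier N"
      using rmodule_homD(1)[OF f] by auto
    with insert show ?case
      by (simp add: M.M.finsum_insert N.M.finsum_insert M.M.finsum_closed rmodule_homD[OF f])
  qed
qed

lemma hom_lin_ext:
  assumes "right_module R M" "right_module R N" and f: "f \<in> rmodule_hom R M N"
    and c: "c \<in> X \<rightarrow> carrier M" and \<phi>: "\<phi> \<in> carrier (free_rmodule R X)"
  shows "f (lin_ext R M c \<phi>) = lin_ext R N (\<lambda>x. f (c x)) \<phi>"
proof -
  interpret M: right_module R M by fact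
  interpret N: right_module R N by fact
  let ?A = "{x. \<phi> x \<noteq> \<zero>\<^bsub>R\<^esub>}"
  have A: "finite ?A" "?A \<subseteq> X" and \<phi>v: "\<And>x. \<phi> x \<in> carrier R"
    using \<phi> by (auto simp: free_rmodule_carrier)
  have cv: "c x \<in> carrier M" if "x \<in> ?A" for x
    using that c A(2) by (auto simp: Pi_iff subset_iff)
  have "f (lin_ext R M c \<phi>) = (\<Oplus>\<^bsub>N\<^esub>x\<in>?A. f (c x \<cdot>\<^bsub>M\<^esub> \<phi> x))"
    unfolding lin_ext_def by (rule hom_finsum[OF assms(1-3) A(1)]) (use cv \<phi>v in auto)
  also have "\<dots> = lin_ext R N (\<lambda>x. f (c x)) \<phi>"
    unfolding lin_ext_def
    by (rule N.M.finsum_cong') (use cv \<phi>v rmodule_homD[OF f] in auto)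
  finally show ?thesis .
qed

theorem projective_lifting:
  fixes R :: "('r, 'x) ring_scheme" and M :: "('r, 'm) rmodule"
    and N :: "('r, 'n) rmodule" and L :: "('r, 'l) rmodule"
  assumes proj: "projective_rmodule R M"
    and N: "right_module R N" and L: "right_module R L"
    and g: "g \<in> rmodule_hom R N L" and surj: "g ` carrier N = carrier L"
    and f: "f \<in> rmodule_hom R M L"
  shows "\<exists>h \<in> rmodule_hom R M N. \<forall>x\<in>carrier M. g (h x) = f x"
proof -
  have M: "right_module R M" using proj by (simp add: projective_rmodule_def)
  interpret M: right_module R M by fact
  interpret N: right_module R N by fact
  let ?F = "free_rmodule R (carrier M)"
  let ?p = "lin_ext R M (\<lambda>x. x)"
  have F: "right_module R ?F" by (rule M.R.right_module_free_rmodule)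
  have p: "?p \<in> rmodule_hom R ?F M" by (rule M.lin_ext_hom) auto
  have "(\<lambda>x. x) \<in> rmodule_hom R M M" by (rule rmodule_homI) auto
  from proj[unfolded projective_rmodule_def, THEN conjunct2, rule_format,
      OF p this F M M.lin_ext_surj]
  obtain s where s: "s \<in> rmodule_hom R M ?F" and ps: "\<And>x. x \<in> carrier M \<Longrightarrow> ?p (s x) = x"
    by auto
  have "\<forall>x\<in>carrier M. \<exists>n\<in>carrier N. g n = f x"
    using surj rmodule_homD(1)[OF f] by (metis imageE)
  then obtain c where c: "\<And>x. x \<in> carrier M \<Longrightarrow> c x \<in> carrier N"
    and gc: "\<And>x. x \<in> carrier M \<Longrightarrow> g (c x) = f x" by metis
  have q: "lin_ext R N c \<in> rmodule_hom R ?F N"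
    by (rule N.lin_ext_hom) (use c in auto)
  define h where "h x = lin_ext R N c (s x)" for x
  have "h \<in> rmodule_hom R M N"
    by (rule rmodule_homI) (simp_all add: h_def rmodule_homD[OF s] rmodule_homD[OF q])
  moreover have "g (h x) = f x" if x: "x \<in> carrier M" for x
  proof -
    have sx: "s x \<in> carrier ?F" by (rule rmodule_homD(1)[OF s x])
    have "g (h x) = lin_ext R L (\<lambda>x. g (c x)) (s x)"
      unfolding h_def by (rule hom_lin_ext[OF N L g _ sx]) (use c in auto)
    also have "\<dots> = lin_ext R L (\<lambda>x. f x) (s x)"
    proof -
      interpret L: right_module R L by fact
      show ?thesis unfolding lin_ext_def
        by (rule L.M.finsum_cong')
           (use sx gc rmodule_homD(1)[OF f] in \<open>auto simp: free_rmodule_carrier subset_iff\<close>)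
    qed
    also have "\<dots> = f (?p (s x))"
      by (rule hom_lin_ext[OF M L f _ sx, symmetric]) auto
    also have "\<dots> = f x" using ps[OF x] by simp
    finally show ?thesis .
  qed
  ultimately show ?thesis by blast
qed

end

theory Submission
  imports Defs
begin

text \<open>Write \<open>S\<close> for the endomorphism ring of \<open>M\<close>. All three conditions say that, for every \<open>f \<in> S\<close>,
  certain images, kernels, annihilators or principal right ideals are those of central elements.
  In a ring with von Neumann regular center every central \<open>z = z x z\<close> may be replaced by the central
  idempotent \<open>e = z x\<close>, which has the same image, kernel, right ideal and right annihilator. So each
  condition becomes a statement about a decomposition \<open>M = e M \<oplus> (1 - e) M\<close> into fully invariant
  summands, or \<open>S = e S \<times> (1 - e) S\<close> into rings.

  The three conditions then meet in a fourth one: every \<open>f\<close> is a unit of the ring \<open>(1 - e) S\<close> for some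
  central idempotent \<open>e\<close> (\<open>corner_unit\<close>). From such an \<open>e\<close> one reads off
  \<open>im f = (1 - e) M\<close> and \<open>ker f = e M\<close>, and likewise \<open>f S = (1 - e) S\<close> and \<open>r.ann f = e S\<close>.
  Conversely, two observations are needed.

  \<^item> If \<open>f S = (1 - e) S\<close>, then \<open>f\<close> has a right inverse \<open>y\<close> in \<open>(1 - e) S\<close>. As \<open>f (1 - y f) = 0\<close>, the
    element \<open>1 - y f\<close> lies in \<open>r.ann f = e S\<close>, so \<open>y\<close> is also a left inverse
    (\<open>corner_unitI_right_ideals\<close>).
  \<^item> If \<open>im f = ker e\<close> and \<open>ker f = im e'\<close> for central idempotents \<open>e\<close> and \<open>e'\<close>, then \<open>e = e'\<close>: since
    \<open>f\<close> commutes with both idempotents, it maps the complement \<open>(1 - e') M\<close> of its kernel into itself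
    and onto \<open>(1 - e) M\<close>, while \<open>f e = e f = 0\<close> gives \<open>e M \<subseteq> e' M\<close>
    (\<open>central_idempotent_im_ker_unique\<close>). Hence \<open>f\<close> is bijective on \<open>(1 - e) M\<close>, and \<open>f + e\<close> is an
    automorphism of \<open>M\<close> whose inverse also inverts \<open>f\<close> there (\<open>corner_unitI_im_ker\<close>).\<close>

section \<open>Units of the complement of a central idempotent\<close>

text \<open>The element \<open>f\<close> is a unit of the ring \<open>(1 - e) T\<close>, with inverse \<open>(1 - e) y\<close> for
  any witness \<open>y\<close>. The equation \<open>f y = 1 - e\<close> is written additively so that
  it can be evaluated pointwise in endomorphism rings.\<close>

definition corner_unit :: "('a, 'x) ring_scheme \<Rightarrow> 'a \<Rightarrow> 'a \<Rightarrow> bool" where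
  "corner_unit T e f \<longleftrightarrow>
     e \<in> ring_center T \<and> e \<otimes>\<^bsub>T\<^esub> e = e \<and> e \<otimes>\<^bsub>T\<^esub> f = \<zero>\<^bsub>T\<^esub> \<and>
     (\<exists>y\<in>carrier T. f \<otimes>\<^bsub>T\<^esub> y \<oplus>\<^bsub>T\<^esub> e = \<one>\<^bsub>T\<^esub> \<and> y \<otimes>\<^bsub>T\<^esub> f \<oplus>\<^bsub>T\<^esub> e = \<one>\<^bsub>T\<^esub>)"

section \<open>Annihilators and principal right ideals\<close>

lemma (in abelian_group) eq_if_minus_eq_zero:
  assumes "x \<ominus> y = \<zero>" "x \<in> carrier G" "y \<in> carrier G"
  shows "x = y"
proof -
  have "x = (x \<ominus> y) \<oplus> y" using assms(2,3) by (simp add: minus_eq a_assoc l_neg)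
  then show ?thesis using assms by simp
qed

context ring
begin

lemma ring_center_mult_closed:
  assumes "z \<in> ring_center R" "w \<in> ring_center R"
  shows "z \<otimes> w \<in> ring_center R"
proof -
  interpret Z: cring "center_ring R" by (rule cring_center_ring)
  show ?thesis using Z.m_closed assms by (simp add: center_ring_def)
qed

lemma regular_center_idempotent:
  assumes reg: "von_neumann_regular (center_ring R)" and z: "z \<in> ring_center R"
  obtains e x where "e \<in> ring_center R" "x \<in> ring_center R" "e \<otimes> e = e"
    "e = z \<otimes> x" "z = e \<otimes> z"
proof -
  obtain x where x: "x \<in> ring_center R" and zxz: "z = z \<otimes> x \<otimes> z"
    using reg z by (auto simp: von_neumann_regular_def center_ring_def)
  note c = ring_centerD(1)[OF z] ring_centerD(1)[OF x]
  have "z \<otimes> x \<otimes> (z \<otimes> x) = z \<otimes> x \<otimes> z \<otimes> x" using c by (simp add: m_assoc)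
  then have "z \<otimes> x \<otimes> (z \<otimes> x) = z \<otimes> x" by (simp only: zxz[symmetric])
  then show thesis
    using that[of "z \<otimes> x" x] ring_center_mult_closed[OF z x] x zxz by simp
qed

lemma mem_principal_right_ideal: "x \<in> a <# carrier R \<longleftrightarrow> (\<exists>s\<in>carrier R. x = a \<otimes> s)"
  by (auto simp: l_coset_def)

lemma corner_unit_right_ideals:
  assumes "corner_unit R e f" and f: "f \<in> carrier R"
  shows "r_ann R f = e <# carrier R" and "f <# carrier R = r_ann R e"
proof -
  obtain y where eZ: "e \<in> ring_center R" and ef: "e \<otimes> f = \<zero>"
    and y: "y \<in> carrier R" and fy: "f \<otimes> y \<oplus> e = \<one>" and yf: "y \<otimes> f \<oplus> e = \<one>"
    using assms by (auto simp: corner_unit_def)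
  have e: "e \<in> carrier R" by (rule ring_centerD(1)[OF eZ])
  have fe: "f \<otimes> e = \<zero>" using ring_centerD(2)[OF eZ f] ef by simp
  show "r_ann R f = e <# carrier R"
  proof (intro equalityI subsetI)
    fix x assume "x \<in> r_ann R f"
    then have x: "x \<in> carrier R" and fx: "f \<otimes> x = \<zero>" by (auto simp: r_ann_def)
    have "x = (y \<otimes> f \<oplus> e) \<otimes> x" using yf x by simp
    also have "\<dots> = e \<otimes> x" using e f y x fx by (simp add: l_distr m_assoc)
    finally show "x \<in> e <# carrier R" using x mem_principal_right_ideal by blast
  next
    fix x assume "x \<in> e <# carrier R"
    then obtain s where s: "s \<in> carrier R" and x: "x = e \<otimes> s"
      using mem_principal_right_ideal by blast
    then show "x \<in> r_ann R f" using e f fe by (simp add: r_ann_def m_assoc[symmetric])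
  qed
  show "f <# carrier R = r_ann R e"
  proof (intro equalityI subsetI)
    fix x assume "x \<in> f <# carrier R"
    then obtain s where s: "s \<in> carrier R" and x: "x = f \<otimes> s"
      using mem_principal_right_ideal by blast
    then show "x \<in> r_ann R e" using e f ef by (simp add: r_ann_def m_assoc[symmetric])
  next
    fix x assume "x \<in> r_ann R e"
    then have x: "x \<in> carrier R" and ex: "e \<otimes> x = \<zero>" by (auto simp: r_ann_def)
    have "x = (f \<otimes> y \<oplus> e) \<otimes> x" using fy x by simp
    also have "\<dots> = f \<otimes> (y \<otimes> x)" using e f y x ex by (simp add: l_distr m_assoc)
    finally show "x \<in> f <# carrier R" using x y mem_principal_right_ideal by blast
  qed
qed

text \<open>A right inverse of \<open>f\<close> in \<open>(1 - e) R\<close> exists because \<open>1 - e \<in> f R\<close>. It is two-sided because the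
  right annihilator of \<open>f\<close> meets \<open>(1 - e) R\<close> trivially.\<close>

lemma corner_unitI_right_ideals:
  assumes eZ: "e \<in> ring_center R" and ee: "e \<otimes> e = e" and f: "f \<in> carrier R"
    and ann: "r_ann R f = e <# carrier R" and ideal: "f <# carrier R = r_ann R e"
  shows "corner_unit R e f"
proof -
  have e: "e \<in> carrier R" by (rule ring_centerD(1)[OF eZ])
  have "f \<in> f <# carrier R" using mem_principal_right_ideal f by (metis one_closed r_one)
  then have ef: "e \<otimes> f = \<zero>" by (simp add: ideal r_ann_def)
  have "\<one> \<ominus> e \<in> r_ann R e" using e ee by (simp add: r_ann_def minus_eq r_distr r_minus r_neg)
  then obtain y where y: "y \<in> carrier R" and fy: "\<one> \<ominus> e = f \<otimes> y"
    using ideal mem_principal_right_ideal by blast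
  have "f \<otimes> (\<one> \<ominus> y \<otimes> f) = f \<ominus> (f \<otimes> y) \<otimes> f"
    using f y by (simp add: minus_eq r_distr r_minus m_assoc)
  also have "\<dots> = \<zero>"
    using e f ef by (simp add: fy[symmetric] minus_eq l_distr l_minus r_neg)
  finally have "\<one> \<ominus> y \<otimes> f \<in> r_ann R f" using y f by (simp add: r_ann_def)
  then obtain s where s: "s \<in> carrier R" and yf: "\<one> \<ominus> y \<otimes> f = e \<otimes> s"
    using ann mem_principal_right_ideal by blast
  \<comment> \<open>The inverse of \<open>f\<close> is the component \<open>(1 - e) y\<close>; multiplying \<open>1 - y f = e s\<close> by \<open>1 - e\<close>
    kills the right-hand side.\<close>
  let ?y = "(\<one> \<ominus> e) \<otimes> y"
  have comm: "f \<otimes> (\<one> \<ominus> e) = f"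
    using e f ef ring_centerD(2)[OF eZ f] by (simp add: minus_eq r_distr r_minus)
  have "f \<otimes> ?y = f \<otimes> (\<one> \<ominus> e) \<otimes> y" using e f y by (simp add: m_assoc)
  then have "f \<otimes> ?y = \<one> \<ominus> e" by (simp only: comm fy[symmetric])
  then have 1: "f \<otimes> ?y \<oplus> e = \<one>" using e by (simp add: minus_eq a_assoc l_neg)
  have "(\<one> \<ominus> e) \<otimes> (e \<otimes> s) = \<zero>"
    using e s ee by (simp add: minus_eq l_distr l_minus m_assoc[symmetric] r_neg)
  then have "(\<one> \<ominus> e) \<otimes> (\<one> \<ominus> y \<otimes> f) = \<zero>" by (simp add: yf)
  then have "(\<one> \<ominus> e) \<ominus> ?y \<otimes> f = \<zero>"
    unfolding minus_eq[of \<one> "y \<otimes> f"] minus_eq[of "\<one> \<ominus> e"]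
    using e f y by (simp add: r_distr r_minus m_assoc)
  then have "?y \<otimes> f = \<one> \<ominus> e" by (rule eq_if_minus_eq_zero[symmetric]) (use e f y in simp_all)
  then have 2: "?y \<otimes> f \<oplus> e = \<one>" using e by (simp add: minus_eq a_assoc l_neg)
  show ?thesis
    unfolding corner_unit_def using eZ ee ef 1 2 e y by (intro conjI bexI[of _ ?y]) auto
qed

theorem right_centrally_morphic_iff_corner_unit:
  assumes reg: "von_neumann_regular (center_ring R)"
  shows "right_centrally_morphic R \<longleftrightarrow> (\<forall>f\<in>carrier R. \<exists>e. corner_unit R e f)"
proof (intro iffI ballI)
  fix f assume R: "right_centrally_morphic R" and f: "f \<in> carrier R"
  then obtain b where b: "b \<in> ring_center R"
    and ann: "r_ann R f = b <# carrier R" and ideal: "f <# carrier R = r_ann R b"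
    by (auto simp: right_centrally_morphic_def)
  obtain e x where e: "e \<in> ring_center R" and x: "x \<in> ring_center R" and ee: "e \<otimes> e = e"
    and ebx: "e = b \<otimes> x" and beb: "b = e \<otimes> b"
    using regular_center_idempotent[OF reg b] .
  note c = ring_centerD(1)[OF b] ring_centerD(1)[OF e] ring_centerD(1)[OF x]
  have exb: "e = x \<otimes> b" using ebx ring_centerD(2)[OF b c(3)] by simp
  have bbe: "b = b \<otimes> e" using beb unfolding ring_centerD(2)[OF b c(2)] .
  have "b <# carrier R = e <# carrier R"
  proof (intro equalityI subsetI)
    fix t assume "t \<in> b <# carrier R"
    then obtain s where "s \<in> carrier R" "t = b \<otimes> s" using mem_principal_right_ideal by blast
    then have "b \<otimes> s \<in> carrier R" "t = e \<otimes> (b \<otimes> s)"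
      using c by (simp_all add: m_assoc[symmetric] beb[symmetric])
    then show "t \<in> e <# carrier R" using mem_principal_right_ideal by blast
  next
    fix t assume "t \<in> e <# carrier R"
    then obtain s where "s \<in> carrier R" "t = e \<otimes> s" using mem_principal_right_ideal by blast
    then have "x \<otimes> s \<in> carrier R" "t = b \<otimes> (x \<otimes> s)"
      using c ebx by (simp_all add: m_assoc)
    then show "t \<in> b <# carrier R" using mem_principal_right_ideal by blast
  qed
  moreover have "b \<otimes> t = \<zero> \<longleftrightarrow> e \<otimes> t = \<zero>" if "t \<in> carrier R" for t
  proof
    assume "b \<otimes> t = \<zero>"
    then show "e \<otimes> t = \<zero>" using exb c that by (simp add: m_assoc)
  next
    assume "e \<otimes> t = \<zero>"
    then have "b \<otimes> e \<otimes> t = \<zero>" using c that by (simp add: m_assoc)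
    then show "b \<otimes> t = \<zero>" by (simp only: bbe[symmetric])
  qed
  then have "r_ann R b = r_ann R e" by (auto simp: r_ann_def)
  ultimately show "\<exists>e. corner_unit R e f"
    using corner_unitI_right_ideals[OF e ee f] ann ideal by auto
next
  assume "\<forall>f\<in>carrier R. \<exists>e. corner_unit R e f"
  then show "right_centrally_morphic R"
    unfolding right_centrally_morphic_def using corner_unit_right_ideals ring_axioms
    by (metis corner_unit_def)
qed

end

section \<open>Images and kernels of endomorphisms\<close>

context right_module
begin

abbreviation S where "S \<equiv> End_ring R M"

lemma End_ring_apply:
  assumes "x \<in> carrier M"
  shows "(f \<otimes>\<^bsub>S\<^esub> g) x = f (g x)" "(f \<oplus>\<^bsub>S\<^esub> g) x = f x \<oplus>\<^bsub>M\<^esub> g x"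
    "\<one>\<^bsub>S\<^esub> x = x" "\<zero>\<^bsub>S\<^esub> x = \<zero>\<^bsub>M\<^esub>"
  using assms by (simp_all add: End_ring_simps compose_def)

lemma End_ring_add:
  assumes "f \<in> carrier S" "x \<in> carrier M" "y \<in> carrier M"
  shows "f (x \<oplus>\<^bsub>M\<^esub> y) = f x \<oplus>\<^bsub>M\<^esub> f y"
  using assms rmodule_homD(2) by (fastforce simp: End_ring_simps)

lemma End_ring_zero:
  assumes "f \<in> carrier S"
  shows "f \<zero>\<^bsub>M\<^esub> = \<zero>\<^bsub>M\<^esub>"
  using assms rmodule_hom_zero[OF right_module_axioms right_module_axioms]
  by (simp add: End_ring_simps)

lemma End_ring_neg:
  assumes f: "f \<in> carrier S" and x: "x \<in> carrier M"
  shows "f (\<ominus>\<^bsub>M\<^esub> x) = \<ominus>\<^bsub>M\<^esub> f x"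
proof -
  have "f (\<ominus>\<^bsub>M\<^esub> x) \<oplus>\<^bsub>M\<^esub> f x = \<zero>\<^bsub>M\<^esub>"
    using End_ring_add[OF f, of "\<ominus>\<^bsub>M\<^esub> x" x] End_ring_zero[OF f] x by (simp add: M.l_neg)
  then show ?thesis using f x by (simp add: End_ring_closed M.minus_equality)
qed

lemma End_ring_minus:
  assumes "f \<in> carrier S" "x \<in> carrier M" "y \<in> carrier M"
  shows "f (x \<ominus>\<^bsub>M\<^esub> y) = f x \<ominus>\<^bsub>M\<^esub> f y"
  using assms by (simp add: M.minus_eq End_ring_add End_ring_neg)

lemma End_ring_center_apply:
  assumes "z \<in> ring_center S" "f \<in> carrier S" "x \<in> carrier M"
  shows "z (f x) = f (z x)"
  using ring_centerD(2)[OF assms(1,2)] End_ring_apply(1)[OF assms(3)] by metis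

lemma mem_rmodule_ker: "x \<in> rmodule_ker M f \<longleftrightarrow> x \<in> carrier M \<and> f x = \<zero>\<^bsub>M\<^esub>"
  by (auto simp: a_kernel_def kernel_def)

lemma bij_endomorphism_inverse:
  assumes f: "f \<in> carrier S" and bij: "bij_betw f (carrier M) (carrier M)"
  obtains u where "u \<in> carrier S" "\<And>x. x \<in> carrier M \<Longrightarrow> f (u x) = x"
    "\<And>x. x \<in> carrier M \<Longrightarrow> u (f x) = x"
proof -
  let ?i = "inv_into (carrier M) f"
  have inj: "inj_on f (carrier M)" and surj: "f ` carrier M = carrier M"
    using bij by (auto simp: bij_betw_def)
  have ic: "?i x \<in> carrier M" and fi: "f (?i x) = x" if "x \<in> carrier M" for x
    using that surj by (metis inv_into_into, metis f_inv_into_f)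
  have act: "f (x \<cdot>\<^bsub>M\<^esub> a) = f x \<cdot>\<^bsub>M\<^esub> a" if "x \<in> carrier M" "a \<in> carrier R" for x a
    using f that rmodule_homD(3) by (fastforce simp: End_ring_simps)
  have "?i \<in> rmodule_hom R M M"
  proof (rule rmodule_homI)
    fix x y assume xy: "x \<in> carrier M" "y \<in> carrier M"
    show "?i (x \<oplus>\<^bsub>M\<^esub> y) = ?i x \<oplus>\<^bsub>M\<^esub> ?i y"
      by (rule inj_onD[OF inj]) (simp_all add: xy ic fi End_ring_add[OF f])
  next
    fix x a assume xa: "x \<in> carrier M" "a \<in> carrier R"
    show "?i (x \<cdot>\<^bsub>M\<^esub> a) = ?i x \<cdot>\<^bsub>M\<^esub> a"
      by (rule inj_onD[OF inj]) (simp_all add: xa ic fi act)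
  qed (rule ic)
  then show thesis
    using that[OF End_ringI[of ?i]] fi inj End_ring_closed[OF f] by simp
qed

lemma corner_unit_im_ker:
  assumes "corner_unit S e f" and f: "f \<in> carrier S"
  shows "rmodule_im M f = rmodule_ker M e" and "rmodule_ker M f = rmodule_im M e"
proof -
  obtain y where eZ: "e \<in> ring_center S" and ef: "e \<otimes>\<^bsub>S\<^esub> f = \<zero>\<^bsub>S\<^esub>"
    and y: "y \<in> carrier S" and fy: "f \<otimes>\<^bsub>S\<^esub> y \<oplus>\<^bsub>S\<^esub> e = \<one>\<^bsub>S\<^esub>"
    and yf: "y \<otimes>\<^bsub>S\<^esub> f \<oplus>\<^bsub>S\<^esub> e = \<one>\<^bsub>S\<^esub>"
    using assms by (auto simp: corner_unit_def)
  have e: "e \<in> carrier S" by (rule ring_centerD(1)[OF eZ])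
  note cl = End_ring_closed[OF f] End_ring_closed[OF e] End_ring_closed[OF y]
  have efx: "e (f x) = \<zero>\<^bsub>M\<^esub>" and fyx: "f (y x) \<oplus>\<^bsub>M\<^esub> e x = x" and yfx: "y (f x) \<oplus>\<^bsub>M\<^esub> e x = x"
    if "x \<in> carrier M" for x
    using that ef fy yf End_ring_apply by metis+
  show "rmodule_im M f = rmodule_ker M e"
  proof (intro equalityI subsetI)
    fix x assume "x \<in> rmodule_ker M e"
    then have x: "x \<in> carrier M" "f (y x) = x"
      using fyx[of x] cl by (auto simp: mem_rmodule_ker)
    then show "x \<in> rmodule_im M f" using cl by (metis imageI)
  qed (auto simp: mem_rmodule_ker efx cl)
  show "rmodule_ker M f = rmodule_im M e"
  proof (intro equalityI subsetI)
    fix x assume "x \<in> rmodule_ker M f"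
    then have x: "x \<in> carrier M" "e x = x"
      using yfx[of x] cl End_ring_zero[OF y] by (auto simp: mem_rmodule_ker)
    then show "x \<in> rmodule_im M e" by (metis imageI)
  qed (auto simp: mem_rmodule_ker efx cl End_ring_center_apply[OF eZ f, symmetric])
qed

lemma idempotent_complement_in_ker:
  assumes e: "e \<in> carrier S" and ee: "e \<otimes>\<^bsub>S\<^esub> e = e" and x: "x \<in> carrier M"
  shows "x \<ominus>\<^bsub>M\<^esub> e x \<in> rmodule_ker M e"
proof -
  have "e (e x) = e x" using ee x End_ring_apply(1) by metis
  then show ?thesis
    using e x by (simp add: mem_rmodule_ker End_ring_add End_ring_neg End_ring_closed M.minus_eq M.r_neg)
qed

text \<open>From \<open>f e = e f = 0\<close> one gets \<open>e M \<subseteq> ker f = e' M\<close>, that is \<open>e' e = e\<close>. For the other inclusion,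
  \<open>n \<in> e' M\<close> gives \<open>n - e n \<in> ker e = im f\<close>, so \<open>n - e n = f k\<close>; applying \<open>e'\<close> fixes the left-hand
  side and sends the right-hand side to \<open>e' (f k) = f (e' k) = 0\<close>.\<close>

lemma central_idempotent_im_ker_unique:
  assumes eZ: "e \<in> ring_center S" and ee: "e \<otimes>\<^bsub>S\<^esub> e = e"
    and eZ': "e' \<in> ring_center S" and ee': "e' \<otimes>\<^bsub>S\<^esub> e' = e'"
    and f: "f \<in> carrier S"
    and im: "rmodule_im M f = rmodule_ker M e" and ker: "rmodule_ker M f = rmodule_im M e'"
  shows "e' = e"
proof -
  note e = ring_centerD(1)[OF eZ] and e' = ring_centerD(1)[OF eZ']
  note cl = End_ring_closed[OF f] End_ring_closed[OF e] End_ring_closed[OF e']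
  have id': "e' (e' x) = e' x" if "x \<in> carrier M" for x
    using that ee' End_ring_apply(1) by metis
  have e'e: "e' (e x) = e x" if x: "x \<in> carrier M" for x
  proof -
    have "f x \<in> rmodule_ker M e" using im x by blast
    then have "f (e x) = \<zero>\<^bsub>M\<^esub>"
      using End_ring_center_apply[OF eZ f x] by (simp add: mem_rmodule_ker)
    then have "e x \<in> rmodule_ker M f" using x cl by (simp add: mem_rmodule_ker)
    then have "e x \<in> rmodule_im M e'" by (simp only: ker)
    then show ?thesis using id' by auto
  qed
  have "e' x = e x" if x: "x \<in> carrier M" for x
  proof -
    let ?n = "e' x"
    have n: "?n \<in> carrier M" using x cl by simp
    have "?n \<ominus>\<^bsub>M\<^esub> e ?n \<in> rmodule_im M f"
      using idempotent_complement_in_ker[OF e ee n] im by simp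
    then obtain k where k: "k \<in> carrier M" and nk: "?n \<ominus>\<^bsub>M\<^esub> e ?n = f k" by auto
    have "?n \<ominus>\<^bsub>M\<^esub> e ?n = e' (?n \<ominus>\<^bsub>M\<^esub> e ?n)"
      using n x cl by (simp add: End_ring_minus[OF e'] id' e'e)
    also have "\<dots> = f (e' k)"
      unfolding nk by (rule End_ring_center_apply[OF eZ' f k])
    also have "\<dots> = \<zero>\<^bsub>M\<^esub>"
    proof -
      have "e' k \<in> rmodule_ker M f" using ker k by simp
      then show ?thesis by (simp add: mem_rmodule_ker)
    qed
    finally have "?n = e ?n" by (rule M.eq_if_minus_eq_zero) (use n cl in simp_all)
    then show ?thesis
      using End_ring_center_apply[OF eZ e' x] e'e[OF x] by simp
  qed
  then show ?thesis using e e' by (intro End_ring_ext) auto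
qed

text \<open>The map \<open>f + e\<close> acts on \<open>M = (1 - e) M \<oplus> e M\<close> as \<open>f\<close> on the first and as the identity on the second
  summand, hence is bijective. Its inverse \<open>u\<close> inverts \<open>f\<close> on \<open>(1 - e) M\<close> and is the identity on \<open>e M\<close>,
  where \<open>f\<close> vanishes; so \<open>f u = u f = 1 - e\<close>.\<close>

lemma corner_unitI_im_ker:
  assumes eZ: "e \<in> ring_center S" and ee: "e \<otimes>\<^bsub>S\<^esub> e = e" and f: "f \<in> carrier S"
    and im: "rmodule_im M f = rmodule_ker M e" and ker: "rmodule_ker M f = rmodule_im M e"
  shows "corner_unit S e f"
proof -
  interpret S: ring S by (rule ring_End_ring)
  note e = ring_centerD(1)[OF eZ]
  note cl = End_ring_closed[OF f] End_ring_closed[OF e]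
  let ?g = "f \<oplus>\<^bsub>S\<^esub> e"
  have g: "?g \<in> carrier S" using e f by simp
  have id: "e (e x) = e x" if "x \<in> carrier M" for x
    using that ee End_ring_apply(1) by metis
  have efx: "e (f x) = \<zero>\<^bsub>M\<^esub>" if "x \<in> carrier M" for x
    using that im by (auto simp: mem_rmodule_ker set_eq_iff)
  have fex: "f (e x) = \<zero>\<^bsub>M\<^esub>" if "x \<in> carrier M" for x
    using that efx End_ring_center_apply[OF eZ f] by simp
  have eg: "e (?g x) = e x" if "x \<in> carrier M" for x
    using that cl e by (simp add: End_ring_apply End_ring_add efx id)
  have "inj_on ?g (carrier M)"
  proof (rule inj_onI)
    fix x y assume x: "x \<in> carrier M" and y: "y \<in> carrier M" and eq: "?g x = ?g y"
    have exy: "e x = e y" using eg[OF x] eg[OF y] eq by simp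
    then have "f x = f y" using eq x y cl by (simp add: End_ring_apply)
    then have "f (x \<ominus>\<^bsub>M\<^esub> y) = \<zero>\<^bsub>M\<^esub>"
      using x y cl f by (simp add: End_ring_add End_ring_neg M.minus_eq M.r_neg)
    then have "x \<ominus>\<^bsub>M\<^esub> y \<in> rmodule_ker M f" using x y by (simp add: mem_rmodule_ker)
    then have "x \<ominus>\<^bsub>M\<^esub> y \<in> rmodule_im M e" by (simp only: ker)
    then have "e (x \<ominus>\<^bsub>M\<^esub> y) = x \<ominus>\<^bsub>M\<^esub> y" using id by auto
    then have "x \<ominus>\<^bsub>M\<^esub> y = \<zero>\<^bsub>M\<^esub>"
      using x y cl e exy by (simp add: End_ring_add End_ring_neg M.minus_eq M.r_neg)
    then show "x = y" by (rule M.eq_if_minus_eq_zero) (use x y in simp_all)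
  qed
  moreover have "?g ` carrier M = carrier M"
  proof (intro equalityI subsetI)
    fix x assume x: "x \<in> carrier M"
    have "x \<ominus>\<^bsub>M\<^esub> e x \<in> rmodule_im M f"
      using idempotent_complement_in_ker[OF e ee x] im by simp
    then obtain k where k: "k \<in> carrier M" and fk: "f k = x \<ominus>\<^bsub>M\<^esub> e x" by auto
    \<comment> \<open>The preimage of \<open>x\<close> is the \<open>(1 - e) M\<close>-component of \<open>k\<close> plus the \<open>e M\<close>-component of \<open>x\<close>.\<close>
    let ?p = "(k \<ominus>\<^bsub>M\<^esub> e k) \<oplus>\<^bsub>M\<^esub> e x"
    have p: "?p \<in> carrier M" using k x cl by simp
    have "f ?p = x \<ominus>\<^bsub>M\<^esub> e x"
      using k x cl f fk by (simp add: End_ring_add End_ring_neg fex M.minus_eq)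
    moreover have "e ?p = e x"
      using k x cl e by (simp add: End_ring_add End_ring_neg id M.minus_eq M.r_neg)
    ultimately have "?g ?p = x"
      using p x cl by (simp add: End_ring_apply M.minus_eq M.a_assoc M.l_neg)
    then show "x \<in> ?g ` carrier M" using p by (metis imageI)
  qed (use End_ring_closed[OF g] in auto)
  ultimately have "bij_betw ?g (carrier M) (carrier M)" by (simp add: bij_betw_def)
  then obtain u where u: "u \<in> carrier S"
    and gu: "\<And>x. x \<in> carrier M \<Longrightarrow> ?g (u x) = x" and ug: "\<And>x. x \<in> carrier M \<Longrightarrow> u (?g x) = x"
    using bij_endomorphism_inverse[OF g] by blast
  note clu = End_ring_closed[OF u]
  have eu: "e (u x) = e x" if "x \<in> carrier M" for x
    using eg[OF clu[OF that]] gu[OF that] by simp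
  have ue: "u (e x) = e x" if "x \<in> carrier M" for x
    using eu[OF that] End_ring_center_apply[OF eZ u that] by simp
  have "f \<otimes>\<^bsub>S\<^esub> u \<oplus>\<^bsub>S\<^esub> e = \<one>\<^bsub>S\<^esub>"
  proof (rule End_ring_ext)
    fix x assume x: "x \<in> carrier M"
    have "f (u x) \<oplus>\<^bsub>M\<^esub> e x = ?g (u x)" using x clu by (simp add: End_ring_apply eu)
    then show "(f \<otimes>\<^bsub>S\<^esub> u \<oplus>\<^bsub>S\<^esub> e) x = \<one>\<^bsub>S\<^esub> x" using x gu by (simp add: End_ring_apply)
  qed (use e f u in simp_all)
  moreover have "u \<otimes>\<^bsub>S\<^esub> f \<oplus>\<^bsub>S\<^esub> e = \<one>\<^bsub>S\<^esub>"
  proof (rule End_ring_ext)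
    fix x assume x: "x \<in> carrier M"
    have "u (f x) \<oplus>\<^bsub>M\<^esub> e x = u (?g x)"
      using x cl u by (simp add: End_ring_apply End_ring_add ue)
    then show "(u \<otimes>\<^bsub>S\<^esub> f \<oplus>\<^bsub>S\<^esub> e) x = \<one>\<^bsub>S\<^esub> x" using x ug by (simp add: End_ring_apply)
  qed (use e f u in simp_all)
  moreover have "e \<otimes>\<^bsub>S\<^esub> f = \<zero>\<^bsub>S\<^esub>"
    using e f by (intro End_ring_ext) (auto simp: End_ring_apply efx)
  ultimately show ?thesis
    unfolding corner_unit_def using eZ ee u by blast
qed

lemma central_idempotent_same_im_ker:
  assumes reg: "von_neumann_regular (center_ring S)" and z: "z \<in> ring_center S"
  obtains e where "e \<in> ring_center S" "e \<otimes>\<^bsub>S\<^esub> e = e"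
    "rmodule_im M e = rmodule_im M z" "rmodule_ker M e = rmodule_ker M z"
proof -
  interpret S: ring S by (rule ring_End_ring)
  obtain e x where eZ: "e \<in> ring_center S" and xZ: "x \<in> ring_center S" and ee: "e \<otimes>\<^bsub>S\<^esub> e = e"
    and ezx: "e = z \<otimes>\<^bsub>S\<^esub> x" and zez: "z = e \<otimes>\<^bsub>S\<^esub> z"
    using S.regular_center_idempotent[OF reg z] .
  note c = ring_centerD(1)[OF eZ] ring_centerD(1)[OF xZ] ring_centerD(1)[OF z]
  note cl = End_ring_closed[OF c(1)] End_ring_closed[OF c(2)] End_ring_closed[OF c(3)]
  have ez: "e m = z (x m)" and ze: "z m = e (z m)" if "m \<in> carrier M" for m
    using that ezx zez End_ring_apply(1) by metis+
  have ez': "e m = x (z m)" and ze': "z m = z (e m)" if "m \<in> carrier M" for m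
    using that ez ze End_ring_center_apply[OF z] c by metis+
  have "rmodule_im M e = rmodule_im M z"
    using ez ze cl by (metis (no_types, lifting) image_eqI image_subsetI subset_antisym)
  moreover have "rmodule_ker M e = rmodule_ker M z"
    unfolding set_eq_iff mem_rmodule_ker
    using ez' ze' End_ring_zero[OF c(2)] End_ring_zero[OF c(3)] by metis
  ultimately show thesis using that eZ ee by blast
qed

theorem centrally_quasi_morphic_imp_corner_unit:
  assumes reg: "von_neumann_regular (center_ring S)"
    and "centrally_quasi_morphic R M" and f: "f \<in> carrier S"
  shows "\<exists>e. corner_unit S e f"
proof -
  obtain g h where g: "g \<in> ring_center S" and h: "h \<in> ring_center S"
    and im: "rmodule_im M f = rmodule_ker M g" and ker: "rmodule_ker M f = rmodule_im M h"
    using assms by (auto simp: centrally_quasi_morphic_def)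
  obtain e where e: "e \<in> ring_center S" "e \<otimes>\<^bsub>S\<^esub> e = e" "rmodule_im M f = rmodule_ker M e"
    using central_idempotent_same_im_ker[OF reg g] im by metis
  obtain e' where e': "e' \<in> ring_center S" "e' \<otimes>\<^bsub>S\<^esub> e' = e'" "rmodule_ker M f = rmodule_im M e'"
    using central_idempotent_same_im_ker[OF reg h] ker by metis
  have "e' = e"
    by (rule central_idempotent_im_ker_unique[OF e(1,2) e'(1,2) f e(3) e'(3)])
  then show ?thesis using corner_unitI_im_ker e e' f by blast
qed

lemma corner_units_imp_centrally_morphic:
  assumes "\<forall>f\<in>carrier S. \<exists>e. corner_unit S e f"
  shows "centrally_morphic R M"
  unfolding centrally_morphic_def
proof
  fix f assume f: "f \<in> carrier S"
  then obtain e where e: "corner_unit S e f" using assms by blast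
  then have "e \<in> ring_center S" by (simp add: corner_unit_def)
  then show "\<exists>g\<in>ring_center S. rmodule_im M f = rmodule_ker M g \<and> rmodule_ker M f = rmodule_im M g"
    using corner_unit_im_ker[OF e f] by blast
qed

end

section \<open>The equivalence\<close>

theorem corollary2p4:
  fixes R :: "('r, 'x) ring_scheme" and M :: "('r, 'm) rmodule"
  assumes "ring R" and "right_module R M"
    and "projective_rmodule R M"
    and "generates_kernels R M"
    and "von_neumann_regular (center_ring (End_ring R M))"
  shows "(centrally_morphic R M \<longleftrightarrow> centrally_quasi_morphic R M) \<and>
    (centrally_quasi_morphic R M \<longleftrightarrow> right_centrally_morphic (End_ring R M))"
proof -
  interpret right_module R M by fact
  interpret S: ring "End_ring R M" by (rule ring_End_ring)
  have "centrally_morphic R M \<Longrightarrow> centrally_quasi_morphic R M"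
    unfolding centrally_morphic_def centrally_quasi_morphic_def by blast
  moreover have "centrally_quasi_morphic R M \<Longrightarrow>
      \<forall>f\<in>carrier (End_ring R M). \<exists>e. corner_unit (End_ring R M) e f"
    using centrally_quasi_morphic_imp_corner_unit[OF assms(5)] by blast
  ultimately show ?thesis
    using corner_units_imp_centrally_morphic
      S.right_centrally_morphic_iff_corner_unit[OF assms(5)] by blast
qed

end
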